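(* Let $X$ be a Banach space and let $T: X \to X$ be a (possibly nonlinear) operator that is Lipschitz with constant $k$, i.e. $\|T(x)-T(x')\| \le k\|x-x'\|$ for all $x,x'\in X$. Let $\epsilon>0$. Then for every nonzero $\lambda\in\mathbb{R}$ with $|\lambda k|<1$ and every $f\in X$ there exists $y\in X$ such that $$\|\lambda T(y) + f - y\| < \epsilon .$$
   Context: Standing assumption: $\lambda$ is a nonzero real scalar. The equation of interest is $\lambda T(x)+f=x$ with $f\in X$ given. *)

theory Defs
  imports Complex_Main
begin

end

theory Submission
  imports Defs
begin

text \<open>
  The map \<open>F x = \<lambda> T x + f\<close> is a contraction with factor \<open>c = \<bar>\<lambda> k\<bar> < 1\<close>, so along the Picard
  iterates of any starting point the defect \<open>\<parallel>F y - y\<parallel>\<close> decays at least like \<open>c ^ n\<close>.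
\<close>

text \<open>Two consecutive iterates are the images under \<open>F\<close> of the previous
  consecutive pair, so each iteration contributes one factor \<open>c\<close>. The sign condition on
  \<open>c\<close> lets the induction hypothesis be multiplied by it.\<close>

lemma norm_funpow_contraction_step_le:
  fixes F :: "'a::real_normed_vector \<Rightarrow> 'a"
  assumes contr: "\<And>x y. norm (F x - F y) \<le> c * norm (x - y)" and "0 \<le> c"
  shows "norm (F ((F ^^ n) x) - (F ^^ n) x) \<le> c ^ n * norm (F x - x)"
proof (induction n)
  case 0
  show ?case by simp
next
  case (Suc n)
  have "norm (F ((F ^^ Suc n) x) - (F ^^ Suc n) x) \<le> c * norm (F ((F ^^ n) x) - (F ^^ n) x)"
    using contr by simp
  also have "\<dots> \<le> c * (c ^ n * norm (F x - x))"
    using Suc.IH \<open>0 \<le> c\<close> by (rule mult_left_mono)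
  finally show ?case by (simp add: mult.assoc)
qed

lemma contraction_approx_fixpoint:
  fixes F :: "'a::real_normed_vector \<Rightarrow> 'a"
  assumes contr: "\<And>x y. norm (F x - F y) \<le> c * norm (x - y)"
    and "0 \<le> c" "c < 1" "0 < \<epsilon>"
  shows "\<exists>y. norm (F y - y) < \<epsilon>"
proof -
  \<comment> \<open>The starting point 0 is an arbitrary choice; \<open>F 0 - 0\<close> stays
    unsimplified to match the iterate bound at \<open>x = 0\<close>.\<close>
  have "(\<lambda>n. c ^ n * norm (F 0 - 0)) \<longlonglongrightarrow> 0"
    using \<open>0 \<le> c\<close> \<open>c < 1\<close> by (intro tendsto_mult_left_zero LIMSEQ_power_zero) simp
  then have "\<forall>\<^sub>F n in sequentially. c ^ n * norm (F 0 - 0) < \<epsilon>"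
    using \<open>0 < \<epsilon>\<close> by (rule order_tendstoD)
  then obtain n where "c ^ n * norm (F 0 - 0) < \<epsilon>"
    by (auto simp: eventually_sequentially)
  with norm_funpow_contraction_step_le[of F c n 0, OF contr \<open>0 \<le> c\<close>]
  show ?thesis by (meson le_less_trans)
qed

theorem theorem1:
  fixes T :: "'a::banach \<Rightarrow> 'a" and k \<epsilon> :: real
  assumes "\<And>x x'. norm (T x - T x') \<le> k * norm (x - x')"
    and "\<epsilon> > 0"
  shows "\<forall>l::real. l \<noteq> 0 \<longrightarrow> \<bar>l * k\<bar> < 1 \<longrightarrow>
           (\<forall>f::'a. \<exists>y::'a. norm (l *\<^sub>R T y + f - y) < \<epsilon>)"
proof (intro allI impI)
  fix l :: real and f :: 'a
  assume "\<bar>l * k\<bar> < 1"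
  have "norm ((l *\<^sub>R T x + f) - (l *\<^sub>R T y + f)) \<le> \<bar>l * k\<bar> * norm (x - y)" for x y
  proof -
    \<comment> \<open>The translation by \<open>f\<close> cancels in the difference, so only the
      scaling by \<open>l\<close> affects the Lipschitz constant.\<close>
    have "norm ((l *\<^sub>R T x + f) - (l *\<^sub>R T y + f)) = \<bar>l\<bar> * norm (T x - T y)"
      by (simp flip: scaleR_diff_right)
    also have "\<dots> \<le> \<bar>l\<bar> * (k * norm (x - y))"
      using assms(1) by (intro mult_left_mono) auto
    \<comment> \<open>The sign of \<open>k\<close> is not prescribed; passing to its absolute value
      gives the nonnegative factor \<open>\<bar>l * k\<bar>\<close>, which is below 1 by
      assumption.\<close>
    also have "\<dots> \<le> \<bar>l\<bar> * (\<bar>k\<bar> * norm (x - y))"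
      by (intro mult_left_mono mult_right_mono) auto
    finally show ?thesis by (simp add: abs_mult mult.assoc)
  qed
  from contraction_approx_fixpoint[OF this abs_ge_zero \<open>\<bar>l * k\<bar> < 1\<close> \<open>\<epsilon> > 0\<close>]
  show "\<exists>y. norm (l *\<^sub>R T y + f - y) < \<epsilon>" .
qed

end
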